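(* Let $f$ be a transcendental meromorphic function on $\mathbb{C}$ and let $k$ be a positive integer. Let $a_1$ and $a_2$ be complex constants with $a_2\neq 0$. If $\left(a_2 f^2(z)+a_1 f(z)\right)^{(k)}$ is a periodic function, then $f$ is also a periodic function.
   Context: Meromorphic means meromorphic in the whole complex plane $\mathbb{C}$; transcendental means not a rational function. A meromorphic function $h$ is periodic if there is a constant $c\in\mathbb{C}\setminus\{0\}$ with $h(z+c)\equiv h(z)$. Here $f^2$ is the square of $f$ (pointwise power) and $(\cdot)^{(k)}$ denotes the $k$-th derivative with respect to $z$. *)

theory Defs
  imports "HOL-Complex_Analysis.Complex_Analysis"
begin

text \<open>
  Meromorphic functions are total functions \<open>complex \<Rightarrow> complex\<close> whose values at poles (and on
  discrete sets) carry no information: \<open>meromorphic_on\<close> only constrains a function on punctured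
  neighbourhoods. An identity between meromorphic functions on the plane is therefore agreement
  outside a set without limit points, i.e. \<open>\<forall>\<^sub>\<approx>z\<in>UNIV\<close>. In particular \<open>(deriv ^^ k) f\<close> is the
  \<open>k\<close>-th derivative of a meromorphic \<open>f\<close> in this sense, and its junk values at poles play no role.
\<close>

definition rational_function :: "(complex \<Rightarrow> complex) \<Rightarrow> bool" where
  "rational_function f \<longleftrightarrow>
     (\<exists>p q :: complex poly. q \<noteq> 0 \<and> (\<forall>\<^sub>\<approx>z\<in>UNIV. f z = poly p z / poly q z))"

definition transcendental_meromorphic :: "(complex \<Rightarrow> complex) \<Rightarrow> bool" where
  "transcendental_meromorphic f \<longleftrightarrow> f meromorphic_on UNIV \<and> \<not> rational_function f"

definition periodic_meromorphic :: "(complex \<Rightarrow> complex) \<Rightarrow> bool" where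
  "periodic_meromorphic h \<longleftrightarrow> (\<exists>c. c \<noteq> 0 \<and> (\<forall>\<^sub>\<approx>z\<in>UNIV. h (z + c) = h z))"

text \<open>
  For the normalised representatives used by the library (continuous off the poles, value 0 at
  each pole) this is pointwise periodicity.
\<close>

lemma periodic_meromorphic_nicely:
  assumes "h nicely_meromorphic_on UNIV"
  shows "periodic_meromorphic h \<longleftrightarrow> (\<exists>c. c \<noteq> 0 \<and> (\<forall>z. h (z + c) = h z))"
proof
  assume "periodic_meromorphic h"
  then obtain c where c: "c \<noteq> 0" and ev: "\<forall>\<^sub>\<approx>z\<in>UNIV. h (z + c) = h z"
    unfolding periodic_meromorphic_def by blast
  have nice: "remove_sings h z = h z" for z
  proof (cases "is_pole h z")
    case True
    thus ?thesis using is_pole_zero_at_nicely_mero[OF assms True] by simp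
  next
    case False
    thus ?thesis using nicely_meromorphic_on_imp_analytic_at[OF assms _ False] by simp
  qed
  have "h (z + c) = h z" for z
  proof -
    have "eventually (\<lambda>w. h (w + c) = h w) (at z)"
      using ev by (simp add: eventually_cosparse_open_eq)
    hence "remove_sings (\<lambda>w. h (w + c)) z = remove_sings h z"
      by (intro remove_sings_cong) auto
    moreover have "remove_sings (h \<circ> (\<lambda>w. w + c)) z = remove_sings h (z + c)"
      by (rule remove_sings_compose) (simp add: at_to_0' filtermap_filtermap add_ac)
    ultimately show ?thesis by (simp add: nice o_def)
  qed
  with c show "\<exists>c. c \<noteq> 0 \<and> (\<forall>z. h (z + c) = h z)" by blast
qed (auto simp: periodic_meromorphic_def)

end

theory Submission
  imports Defs
begin

text \<open>
  Completing the square, put \<open>g = f + a1 / (2 * a2)\<close>; then \<open>a2 * f\<^sup>2 + a1 * f\<close> is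
  \<open>a2 * g\<^sup>2\<close> up to a constant. If its \<open>k\<close>-th derivative has period \<open>c\<close>, then the \<open>k\<close>-th
  derivative of \<open>g(z + c)\<^sup>2 - g(z)\<^sup>2\<close> vanishes, so this difference is a polynomial \<open>P\<close>. If
  \<open>P = 0\<close>, then \<open>g(z + c) = \<plusminus> g(z)\<close> with one sign for the whole plane, and \<open>c\<close> or \<open>2 * c\<close> is a
  period of \<open>g\<close>, hence of \<open>f\<close>. Everything else serves to show that \<open>P \<noteq> 0\<close> forces \<open>g\<close> to be
  rational.

  Poles are excluded by \<open>no_pole_if_shifted_squares_differ_by_poly\<close>. Choose a polynomial \<open>Q\<close>
  with \<open>Q(z + c) - Q(z) = P(z)\<close>. Then \<open>h = g\<^sup>2 - Q\<close> has period \<open>c\<close>, and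
  \<open>h(z) + Q(z + n * c) = g(z + n * c)\<^sup>2\<close> has only multiple zeros, for every \<open>n\<close>. Near a pole
  \<open>z0\<close> of \<open>h\<close> the functions \<open>1 / h(z) + 1 / Q(z + n * c)\<close> converge to \<open>1 / h\<close>, which vanishes at
  \<open>z0\<close>; by Hurwitz they too have zeros near \<open>z0\<close> for large \<open>n\<close>. At such a zero
  \<open>h = - Q(z + n * c)\<close> and, by multiplicity, \<open>h' = - Q'(z + n * c)\<close>, so \<open>h' / h\<close> is the value of
  \<open>Q' / Q\<close> at a far away point and therefore small. But \<open>h' / h\<close> is large near a pole of \<open>h\<close>.

  The entire case is \<open>entire_square_shift_by_poly_imp_poly\<close>. The three functions \<open>g\<close>,
  \<open>b = g(z + c)\<close>, \<open>d = g(z + 2 * c)\<close> have squares that differ by nonzero polynomials, so that the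
  sums and differences \<open>b \<plusminus> g\<close>, \<open>d \<plusminus> b\<close>, \<open>d \<plusminus> g\<close> all have finitely many zeros. Since
  \<open>(d - g) - (d - b) = b - g\<close>, the quotient \<open>(d - b) / (d - g)\<close> takes each of the values 0, 1
  and \<open>\<infinity>\<close> only finitely often, and the great Picard theorem at infinity makes it rational. The
  same holds for \<open>(d - b) / (d + g)\<close>. Hence \<open>(d + g) / (d - g)\<close> is rational, and as
  \<open>(d + g) * (d - g)\<close> is a polynomial, \<open>g\<^sup>2\<close> is rational too. An entire function with rational
  square grows at most polynomially, so it is a polynomial.
\<close>

section \<open>Complex polynomials\<close>

lemma poly_antiderivative:
  fixes p :: "complex poly"
  shows "\<exists>q. pderiv q = p"
proof
  show "pderiv (\<Sum>i\<le>degree p. monom (coeff p i / of_nat (Suc i)) (Suc i)) = p"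
    using higher_pderiv_sum[of 1 "\<lambda>i. monom (coeff p i / of_nat (Suc i)) (Suc i)" "{..degree p}"]
    by (simp add: pderiv_monom poly_as_sum_of_monoms del: of_nat_Suc)
qed

text \<open>
  Solve the equation for the derivative of \<open>p\<close>, which has smaller degree, and integrate: the
  result is correct up to a constant, and a linear term absorbs that constant.
\<close>
lemma poly_difference_equation:
  fixes p :: "complex poly"
  assumes "c \<noteq> 0"
  shows "\<exists>q. \<forall>z. poly q (z + c) - poly q z = poly p z"
proof (induction "degree p" arbitrary: p rule: less_induct)
  case less
  show ?case
  proof (cases "degree p = 0")
    case True
    then obtain \<kappa> where p: "p = [:\<kappa>:]"
      by (rule degree_eq_zeroE)
    show ?thesis
      by (rule exI[of _ "[:0, \<kappa> / c:]"]) (use assms in \<open>simp add: p field_simps\<close>)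
  next
    case False
    hence "degree (pderiv p) < degree p"
      by (simp add: degree_pderiv)
    from less[OF this] obtain r where r: "\<And>z. poly r (z + c) - poly r z = poly (pderiv p) z"
      by blast
    obtain s where s: "pderiv s = r"
      using poly_antiderivative by blast
    have "pderiv (pcompose s [:c, 1:] - s - p) = 0"
      by (subst poly_eq_poly_eq_iff[symmetric], rule ext)
         (use r in \<open>simp add: pderiv_diff pderiv_pcompose s poly_pcompose pderiv_pCons add.commute\<close>)
    then obtain \<kappa> where \<kappa>': "pcompose s [:c, 1:] - s - p = [:\<kappa>:]"
      using pderiv_iszero by blast
    have \<kappa>: "poly s (z + c) - poly s z - poly p z = \<kappa>" for z
      using arg_cong[of _ _ "\<lambda>p. poly p z", OF \<kappa>'] by (simp add: poly_pcompose add.commute)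
    show ?thesis
      by (rule exI[of _ "s - [:0, \<kappa> / c:]"])
         (use assms \<kappa> in \<open>simp add: field_simps\<close>)
  qed
qed

lemma poly_bounded_below_at_infinity:
  fixes p :: "complex poly"
  assumes "p \<noteq> 0"
  obtains \<delta> R where "\<delta> > 0" "R > 0" "\<And>z. norm z \<ge> R \<Longrightarrow> norm (poly p z) \<ge> \<delta>"
proof (cases "degree p = 0")
  case True
  then obtain \<kappa> where "p = [:\<kappa>:]"
    by (rule degree_eq_zeroE)
  with assms show ?thesis
    by (intro that[of "norm \<kappa>" 1]) auto
next
  case False
  hence "filterlim (poly p) at_infinity at_infinity"
    by (intro filterlim_poly_at_infinity) auto
  hence "eventually (\<lambda>z. norm (poly p z) \<ge> 1) at_infinity"
    by (auto simp: filterlim_at_infinity[of 0])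
  then obtain b where "\<And>z. norm z \<ge> b \<Longrightarrow> norm (poly p z) \<ge> 1"
    by (auto simp: eventually_at_infinity)
  thus ?thesis
    by (intro that[of 1 "max b 1"]) auto
qed

lemma poly_growth:
  fixes p :: "complex poly"
  obtains B where "B \<ge> 0" "\<And>z. norm z \<ge> 1 \<Longrightarrow> norm (poly p z) \<le> B * norm z ^ degree p"
proof -
  define B where "B = (\<Sum>i\<le>degree p. norm (coeff p i))"
  have "norm (poly p z) \<le> B * norm z ^ degree p" if "norm z \<ge> 1" for z
  proof -
    have "norm (poly p z) \<le> (\<Sum>i\<le>degree p. norm (coeff p i) * norm z ^ i)"
      unfolding poly_altdef by (rule order_trans[OF norm_sum]) (simp add: norm_mult norm_power)
    also have "\<dots> \<le> (\<Sum>i\<le>degree p. norm (coeff p i) * norm z ^ degree p)"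
      by (intro sum_mono mult_left_mono power_increasing) (use that in auto)
    finally show ?thesis
      by (simp add: B_def sum_distrib_right)
  qed
  thus ?thesis
    by (intro that[of B]) (auto simp: B_def intro: sum_nonneg)
qed

text \<open>
  This is Liouville's theorem for polynomial growth; a rational bound is turned into this form by
  putting a lower bound for the denominator into \<open>C\<close>.
\<close>
lemma entire_dominated_by_poly_imp_poly:
  assumes F: "F holomorphic_on UNIV"
    and dom: "\<And>z. norm z \<ge> R \<Longrightarrow> norm (F z) \<le> norm (poly q z) * C"
  shows "\<exists>p. \<forall>z. F z = poly p z"
proof -
  obtain B where B: "B \<ge> 0" "\<And>z. norm z \<ge> 1 \<Longrightarrow> norm (poly q z) \<le> B * norm z ^ degree q"
    using poly_growth by blast
  have "norm (F z) \<le> (B * \<bar>C\<bar>) * norm z ^ degree q" if "norm z \<ge> max R 1" for z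
  proof -
    have "norm (F z) \<le> norm (poly q z) * \<bar>C\<bar>"
      using dom[of z] that by (smt (verit) max.bounded_iff mult_left_mono norm_ge_zero)
    also have "\<dots> \<le> (B * norm z ^ degree q) * \<bar>C\<bar>"
      by (intro mult_right_mono B) (use that in auto)
    finally show ?thesis
      by (simp add: mult_ac)
  qed
  note Liouville_polynomial[OF F this]
  hence "F z = poly (\<Sum>k\<le>degree q. monom ((deriv ^^ k) F 0 / fact k) k) z" for z
    unfolding poly_sum poly_monom .
  thus ?thesis
    by blast
qed

section \<open>Entire functions whose square changes by a polynomial under a shift\<close>

text \<open>
  Each of \<open>u\<close>, \<open>v\<close> and \<open>v - u\<close> divides a nonzero polynomial, so \<open>u / v\<close> omits 0, 1 and \<open>\<infinity>\<close>
  near infinity. By the great Picard theorem \<open>u / v\<close> or \<open>v / u\<close> is then bounded near infinity.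
  The cofactors \<open>u'\<close> and \<open>v'\<close> make the zeros of the denominator harmless: \<open>u / v = (u * v') / B\<close>
  and \<open>v / u = (v * u') / A\<close> have entire numerators, and these are polynomials by Liouville.
\<close>
lemma Picard_quotient_of_finitely_many_zeros:
  assumes hol: "u holomorphic_on UNIV" "u' holomorphic_on UNIV"
      "v holomorphic_on UNIV" "v' holomorphic_on UNIV"
    and uu: "\<And>z. u z * u' z = poly A z" and vv: "\<And>z. v z * v' z = poly B z"
    and ww: "\<And>z. (v z - u z) * w z = poly D z"
    and nz: "A \<noteq> 0" "B \<noteq> 0" "D \<noteq> 0"
  shows "\<exists>p q. p \<noteq> 0 \<and> q \<noteq> 0 \<and> (\<forall>z. u z * poly q z = v z * poly p z)"
proof -
  have "A * B * D \<noteq> 0"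
    using nz by simp
  then obtain \<delta> R where R: "\<delta> > 0" "R > 0" "\<And>z. norm z \<ge> R \<Longrightarrow> norm (poly (A * B * D) z) \<ge> \<delta>"
    using poly_bounded_below_at_infinity by blast
  have ne: "u z \<noteq> 0 \<and> u' z \<noteq> 0 \<and> v z \<noteq> 0 \<and> v' z \<noteq> 0 \<and> v z \<noteq> u z" if "norm z \<ge> R" for z
    using R(1) R(3)[OF that] by (auto simp: uu[symmetric] vv[symmetric] ww[symmetric])
  \<comment> \<open>The substitution \<open>x = 1 / z\<close> moves the point at infinity to the origin.\<close>
  define \<phi> where "\<phi> = (\<lambda>x. u (inverse x) / v (inverse x))"
  have far: "norm (inverse x) \<ge> R" if "x \<in> ball 0 (inverse R) - {0}" for x :: complex
    using that \<open>R > 0\<close> by (simp add: norm_inverse norm_divide field_simps)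
  have "\<phi> holomorphic_on (ball 0 (inverse R) - {0})"
    unfolding \<phi>_def
    by (intro holomorphic_intros holomorphic_on_compose_gen[of inverse _ u UNIV, unfolded o_def]
          holomorphic_on_compose_gen[of inverse _ v UNIV, unfolded o_def] hol)
       (use ne[OF far] in auto)
  moreover have "\<phi> x \<noteq> 0 \<and> \<phi> x \<noteq> 1" if "x \<in> ball 0 (inverse R) - {0}" for x
    using ne[OF far[OF that]] by (auto simp: \<phi>_def)
  ultimately obtain l where l: "(\<phi> \<longlongrightarrow> l) (at 0) \<or> ((inverse \<circ> \<phi>) \<longlongrightarrow> l) (at 0)"
    using great_Picard[of "ball 0 (inverse R)" 0 0 1 \<phi>] \<open>R > 0\<close> by auto
  have bound: "\<exists>S C. \<forall>z. norm z \<ge> S \<longrightarrow> norm z \<ge> R \<and> norm (\<psi> (inverse z)) \<le> C"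
    if "(\<psi> \<longlongrightarrow> l) (at 0)" for \<psi> :: "complex \<Rightarrow> complex"
  proof -
    have "((\<lambda>z. \<psi> (inverse z)) \<longlongrightarrow> l) at_infinity"
      using that by (simp add: at_to_infinity filterlim_filtermap)
    hence "eventually (\<lambda>z. norm (\<psi> (inverse z) - l) < 1) at_infinity"
      by (auto simp: tendsto_iff dist_norm)
    then obtain b where b: "\<And>z. norm z \<ge> b \<Longrightarrow> norm (\<psi> (inverse z) - l) < 1"
      by (auto simp: eventually_at_infinity)
    have "norm (\<psi> (inverse z)) \<le> norm l + 1" if "norm z \<ge> b" for z
      using b[OF that] norm_triangle_ineq2[of "\<psi> (inverse z)" l] by simp
    thus ?thesis
      by (intro exI[of _ "max b R"] exI[of _ "norm l + 1"]) auto
  qed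
  from l show ?thesis
  proof
    assume "(\<phi> \<longlongrightarrow> l) (at 0)"
    then obtain S C where S: "\<And>z. norm z \<ge> S \<Longrightarrow> norm z \<ge> R \<and> norm (\<phi> (inverse z)) \<le> C"
      using bound by blast
    have bd: "norm (u z * v' z) \<le> norm (poly B z) * C" if "norm z \<ge> S" for z
    proof -
      have "u z * v' z = poly B z * \<phi> (inverse z)"
        using ne[of z] S[OF that] by (simp add: \<phi>_def flip: vv)
      thus ?thesis
        using S[OF that] by (simp add: norm_mult mult_left_mono)
    qed
    have "(\<lambda>z. u z * v' z) holomorphic_on UNIV"
      by (intro holomorphic_intros hol)
    from entire_dominated_by_poly_imp_poly[OF this bd]
    obtain p where p: "\<And>z. u z * v' z = poly p z"
      by blast
    have "u z * poly B z = v z * poly p z" for z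
      by (simp flip: p vv)
    moreover have "p \<noteq> 0"
      using p[of "of_real R"] ne[of "of_real R"] \<open>R > 0\<close> by auto
    ultimately show ?thesis
      using nz by blast
  next
    assume "((inverse \<circ> \<phi>) \<longlongrightarrow> l) (at 0)"
    then obtain S C where S: "\<And>z. norm z \<ge> S \<Longrightarrow> norm z \<ge> R \<and> norm ((inverse \<circ> \<phi>) (inverse z)) \<le> C"
      using bound by blast
    have bd: "norm (v z * u' z) \<le> norm (poly A z) * C" if "norm z \<ge> S" for z
    proof -
      have "v z * u' z = poly A z * (inverse \<circ> \<phi>) (inverse z)"
        using ne[of z] S[OF that] by (simp add: \<phi>_def flip: uu)
      thus ?thesis
        using S[OF that] by (simp add: norm_mult mult_left_mono)
    qed
    have "(\<lambda>z. v z * u' z) holomorphic_on UNIV"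
      by (intro holomorphic_intros hol)
    from entire_dominated_by_poly_imp_poly[OF this bd]
    obtain q where q: "\<And>z. v z * u' z = poly q z"
      by blast
    have "u z * poly q z = v z * poly A z" for z
      by (simp flip: q uu)
    moreover have "q \<noteq> 0"
      using q[of "of_real R"] ne[of "of_real R"] \<open>R > 0\<close> by auto
    ultimately show ?thesis
      using nz by blast
  qed
qed

text \<open>
  With \<open>b\<close> and \<open>d\<close> the first and the second shift of \<open>g\<close>, Picard's theorem yields \<open>d - b\<close> as a
  rational multiple of \<open>d - g\<close> and of \<open>d + g\<close>. So \<open>(d - g) * X = (d + g) * Y\<close> for polynomials
  \<open>X\<close> and \<open>Y\<close>, and together with \<open>(d - g) * (d + g) = Q\<close> this determines \<open>g\<^sup>2\<close> as a rational
  function.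
\<close>
lemma entire_square_shift_by_poly_imp_poly:
  assumes g: "g holomorphic_on UNIV" and "P \<noteq> 0"
    and eq: "\<And>z. (g (z + c))\<^sup>2 - (g z)\<^sup>2 = poly P z"
  shows "\<exists>p. \<forall>z. g z = poly p z"
proof -
  define b where "b = (\<lambda>z. g (z + c))"
  define d where "d = (\<lambda>z. g (z + 2 * c))"
  define P1 where "P1 = pcompose P [:c, 1:]"
  define Q where "Q = P + P1"
  have hol: "b holomorphic_on UNIV" "d holomorphic_on UNIV"
    unfolding b_def d_def
    by (auto intro!: holomorphic_intros holomorphic_on_compose_gen[of _ _ g UNIV, unfolded o_def] g)
  have bg: "(b z)\<^sup>2 - (g z)\<^sup>2 = poly P z" for z
    using eq by (simp add: b_def)
  have db: "(d z)\<^sup>2 - (b z)\<^sup>2 = poly P1 z" for z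
    using eq[of "z + c"] by (simp add: b_def d_def P1_def poly_pcompose algebra_simps)
  have dg: "(d z)\<^sup>2 - (g z)\<^sup>2 = poly Q z" for z
    using bg[of z] db[of z] by (simp add: Q_def algebra_simps)
  have lead: "lead_coeff P1 = lead_coeff P" "degree P1 = degree P"
    using lead_coeff_comp[of "[:c, 1:]" P] by (simp_all add: P1_def degree_pcompose)
  have "P1 \<noteq> 0"
    using lead \<open>P \<noteq> 0\<close> by auto
  \<comment> \<open>\<open>P\<close> and its shift have the same leading coefficient, so they cannot cancel in the sum.\<close>
  have "Q \<noteq> 0"
  proof
    assume "Q = 0"
    hence "coeff P (degree P) + coeff P1 (degree P) = 0"
      by (metis Q_def coeff_0 coeff_add)
    thus False
      using lead \<open>P \<noteq> 0\<close> by simp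
  qed
  obtain p1 q1 where 1: "p1 \<noteq> 0" "q1 \<noteq> 0" "\<And>z. (d z - b z) * poly q1 z = (d z - g z) * poly p1 z"
  proof -
    have "\<exists>p q. p \<noteq> 0 \<and> q \<noteq> 0 \<and> (\<forall>z. (d z - b z) * poly q z = (d z - g z) * poly p z)"
      by (rule Picard_quotient_of_finitely_many_zeros[where u' = "\<lambda>z. d z + b z" and v' = "\<lambda>z. d z + g z"
            and w = "\<lambda>z. b z + g z" and A = P1 and B = Q and D = P])
         (use \<open>P \<noteq> 0\<close> \<open>Q \<noteq> 0\<close> \<open>P1 \<noteq> 0\<close> in
           \<open>auto intro!: holomorphic_intros hol g simp: power2_eq_square algebra_simps simp flip: bg db dg\<close>)
    thus ?thesis using that by blast
  qed
  obtain p2 q2 where 2: "p2 \<noteq> 0" "q2 \<noteq> 0" "\<And>z. (d z - b z) * poly q2 z = (d z + g z) * poly p2 z"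
  proof -
    have "\<exists>p q. p \<noteq> 0 \<and> q \<noteq> 0 \<and> (\<forall>z. (d z - b z) * poly q z = (d z + g z) * poly p z)"
      by (rule Picard_quotient_of_finitely_many_zeros[where u' = "\<lambda>z. d z + b z" and v' = "\<lambda>z. d z - g z"
            and w = "\<lambda>z. b z - g z" and A = P1 and B = Q and D = P])
         (use \<open>P \<noteq> 0\<close> \<open>Q \<noteq> 0\<close> \<open>P1 \<noteq> 0\<close> in
           \<open>auto intro!: holomorphic_intros hol g simp: power2_eq_square algebra_simps simp flip: bg db dg\<close>)
    thus ?thesis using that by blast
  qed
  define X where "X = p1 * q2"
  define Y where "Y = p2 * q1"
  have "X * Y \<noteq> 0"
    using 1 2 by (simp add: X_def Y_def)
  have XY: "(d z - g z) * poly X z = (d z + g z) * poly Y z" for z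
    using 1(3)[of z] 2(3)[of z] by (simp add: X_def Y_def) algebra
  \<comment> \<open>This comes from \<open>4 * g\<^sup>2 = (d + g)\<^sup>2 + (d - g)\<^sup>2 - 2 * Q\<close>.\<close>
  have rat: "4 * (g z)\<^sup>2 * poly (X * Y) z = poly (Q * (X - Y)\<^sup>2) z" for z
  proof -
    have "(d z - g z)\<^sup>2 * poly X z = poly Q z * poly Y z"
      using XY[of z] dg[of z] by algebra
    moreover have "(d z + g z)\<^sup>2 * poly Y z = poly Q z * poly X z"
      using XY[of z] dg[of z] by algebra
    ultimately show ?thesis
      using dg[of z] by (simp add: poly_power) algebra
  qed
  obtain \<delta> R where R: "\<delta> > 0" "R > 0" "\<And>z. norm z \<ge> R \<Longrightarrow> norm (poly (X * Y) z) \<ge> \<delta>"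
    using poly_bounded_below_at_infinity[OF \<open>X * Y \<noteq> 0\<close>] by blast
  have dom: "norm ((g z)\<^sup>2) \<le> norm (poly (Q * (X - Y)\<^sup>2) z) * (1 / (4 * \<delta>))" if "norm z \<ge> R" for z
  proof -
    have "4 * norm ((g z)\<^sup>2) * \<delta> \<le> 4 * norm ((g z)\<^sup>2) * norm (poly (X * Y) z)"
      by (intro mult_left_mono R(3) that) auto
    also have "\<dots> = norm (poly (Q * (X - Y)\<^sup>2) z)"
      by (simp only: rat[symmetric] norm_mult norm_numeral)
    finally show ?thesis
      using \<open>\<delta> > 0\<close> by (simp add: field_simps)
  qed
  have "(\<lambda>z. (g z)\<^sup>2) holomorphic_on UNIV"
    by (intro holomorphic_intros g)
  from entire_dominated_by_poly_imp_poly[OF this dom]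
  obtain r where r: "\<And>z. (g z)\<^sup>2 = poly r z"
    by blast
  obtain C where C: "C \<ge> 0" "\<And>z. norm z \<ge> 1 \<Longrightarrow> norm (poly r z) \<le> C * norm z ^ degree r"
    using poly_growth by blast
  have "norm (g z) \<le> norm (poly (monom 1 (degree r)) z) * (1 + C)" if "norm z \<ge> 1" for z
  proof -
    have "norm (g z) \<le> 1 + (norm (g z))\<^sup>2"
      using zero_le_power2[of "norm (g z) - 1"] by (simp add: power2_eq_square algebra_simps) (smt (verit) norm_ge_zero)
    also have "\<dots> \<le> norm z ^ degree r + C * norm z ^ degree r"
      using C(2)[OF that] that by (intro add_mono) (auto simp flip: r simp: norm_power one_le_power)
    finally show ?thesis
      by (simp add: poly_monom norm_power algebra_simps)
  qed
  from entire_dominated_by_poly_imp_poly[OF g this] show ?thesis .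
qed

section \<open>Identities between meromorphic functions\<close>

lemma eventually_cosparse_UNIV_shift:
  fixes P :: "complex \<Rightarrow> bool"
  assumes "\<forall>\<^sub>\<approx>z\<in>UNIV. P z"
  shows "\<forall>\<^sub>\<approx>z\<in>UNIV. P (z + c)"
proof -
  have "eventually (\<lambda>z. P (z + c)) (at x)" for x
  proof -
    have "eventually P (at (x + c))"
      using assms by (simp add: eventually_cosparse_open_eq)
    thus ?thesis
      using eventually_at_to_0[of P "x + c"] eventually_at_to_0[of _ x] by (simp add: add_ac)
  qed
  thus ?thesis
    by (simp add: eventually_cosparse_open_eq)
qed

lemma meromorphic_on_UNIV_shift:
  assumes "f meromorphic_on UNIV"
  shows "(\<lambda>z. f (z + c)) meromorphic_on A"
  by (rule meromorphic_on_compose[OF assms]) (auto intro!: analytic_intros)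

text \<open>
  An identity that holds off a closed discrete set may be differentiated off that set, since it
  holds in a neighbourhood of each of the remaining points.
\<close>
lemma eventually_cosparse_UNIV_nhds:
  fixes P :: "complex \<Rightarrow> bool"
  assumes "\<forall>\<^sub>\<approx>z\<in>UNIV. P z"
  shows "\<forall>\<^sub>\<approx>z\<in>UNIV. eventually P (nhds z)"
  unfolding eventually_cosparse_open_eq[OF open_UNIV]
proof
  fix x :: complex
  have "eventually P (at x)"
    using assms by (simp add: eventually_cosparse_open_eq)
  then obtain S where S: "open S" "x \<in> S" "\<And>y. y \<in> S - {x} \<Longrightarrow> P y"
    by (auto simp: eventually_at_topological)
  have "eventually (\<lambda>y. y \<in> S - {x}) (at x)"
    using S by (intro eventually_at_in_open) auto
  thus "eventually (\<lambda>y. eventually P (nhds y)) (at x)"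
  proof eventually_elim
    case (elim y)
    have "eventually (\<lambda>w. w \<in> S - {x}) (nhds y)"
      using elim S by (intro eventually_nhds_in_open) auto
    thus ?case
      by eventually_elim (use S in auto)
  qed
qed

lemma higher_deriv_shift:
  fixes f :: "complex \<Rightarrow> complex"
  shows "(deriv ^^ k) (\<lambda>z. f (z + c)) = (\<lambda>z. (deriv ^^ k) f (z + c))"
proof (induction k)
  case (Suc k)
  have "deriv (\<lambda>w. (deriv ^^ k) f (w + c)) z = deriv ((deriv ^^ k) f) (z + c)" for z
    using deriv_shift_0[of "\<lambda>w. (deriv ^^ k) f (w + c)" z] deriv_shift_0[of "(deriv ^^ k) f" "z + c"]
    by (simp only: o_def add_ac)
  with Suc show ?case
    by simp
qed simp

text \<open>
  The function is constant on some small disc, and the identity theorem for meromorphic functions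
  extends this to the plane.
\<close>
lemma meromorphic_deriv_zero_imp_constant:
  assumes mero: "f meromorphic_on UNIV" and deriv0: "\<forall>\<^sub>\<approx>z\<in>UNIV. deriv f z = 0"
  shows "\<exists>C. \<forall>\<^sub>\<approx>z\<in>UNIV. f z = C"
proof -
  have "\<forall>\<^sub>\<approx>z\<in>UNIV. f analytic_on {z} \<and> deriv f z = 0"
    using meromorphic_on_imp_analytic_cosparse[OF mero] deriv0 by eventually_elim auto
  from eventually_cosparse_UNIV_nhds[OF this]
  have "eventually (\<lambda>z. eventually (\<lambda>w. f analytic_on {w} \<and> deriv f w = 0) (nhds z)) (at 0)"
    by (simp add: eventually_cosparse_open_eq)
  then obtain a where "eventually (\<lambda>w. f analytic_on {w} \<and> deriv f w = 0) (nhds a)"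
    using eventually_happens' trivial_limit_at by blast
  then obtain r where r: "r > 0" "\<And>w. w \<in> ball a r \<Longrightarrow> f analytic_on {w} \<and> deriv f w = 0"
    by (auto simp: eventually_nhds_metric dist_commute)
  have "(f has_field_derivative 0) (at w within ball a r)" if "w \<in> ball a r" for w
    using r(2)[OF that] analytic_derivI by (metis has_field_derivative_at_within)
  then obtain C where C: "\<And>w. w \<in> ball a r \<Longrightarrow> f w = C"
    using has_field_derivative_zero_constant[of "ball a r" f] by auto
  have "eventually (\<lambda>w. w \<in> ball a r) (at a)"
    using r(1) by (intro eventually_at_in_open') auto
  hence "eventually (\<lambda>w. f w = C) (at a)"
    by eventually_elim (use C in auto)
  hence "\<not> eventually (\<lambda>w. f w \<noteq> C) (at a)"
    using eventually_happens'[OF trivial_limit_at] eventually_conj by fastforce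
  hence "\<not> (\<forall>\<^sub>\<approx>w\<in>UNIV. f w \<noteq> C)"
    by (auto simp: eventually_cosparse_open_eq)
  thus ?thesis
    using meromorphic_imp_constant_or_avoid[OF mero, of C] by auto
qed

lemma meromorphic_higher_deriv_zero_imp_poly:
  assumes "f meromorphic_on UNIV" "\<forall>\<^sub>\<approx>z\<in>UNIV. (deriv ^^ k) f z = 0"
  shows "\<exists>p. \<forall>\<^sub>\<approx>z\<in>UNIV. f z = poly p z"
  using assms
proof (induction k arbitrary: f)
  case 0
  thus ?case
    by (intro exI[of _ 0]) auto
next
  case (Suc k)
  have "deriv f meromorphic_on UNIV"
    using Suc.prems by (intro meromorphic_intros)
  moreover have "\<forall>\<^sub>\<approx>z\<in>UNIV. (deriv ^^ k) (deriv f) z = 0"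
    using Suc.prems(2) by (simp only: funpow_Suc_right o_def)
  ultimately obtain p where p: "\<forall>\<^sub>\<approx>z\<in>UNIV. deriv f z = poly p z"
    using Suc.IH by blast
  obtain q where q: "pderiv q = p"
    using poly_antiderivative by blast
  have "\<forall>\<^sub>\<approx>z\<in>UNIV. deriv (\<lambda>w. f w - poly q w) z = 0"
    using p meromorphic_on_imp_analytic_cosparse[OF Suc.prems(1)]
  proof eventually_elim
    case (elim z)
    have "((\<lambda>w. f w - poly q w) has_field_derivative deriv f z - poly (pderiv q) z) (at z)"
      by (intro derivative_intros analytic_derivI elim poly_DERIV)
    thus ?case
      using elim q by (simp add: DERIV_imp_deriv)
  qed
  moreover have "(\<lambda>w. f w - poly q w) meromorphic_on UNIV"
    by (intro meromorphic_intros Suc.prems analytic_on_imp_meromorphic_on)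
       (auto simp: analytic_on_open intro!: holomorphic_intros)
  ultimately obtain C where "\<forall>\<^sub>\<approx>z\<in>UNIV. f z - poly q z = C"
    using meromorphic_deriv_zero_imp_constant by blast
  hence "\<forall>\<^sub>\<approx>z\<in>UNIV. f z = poly (q + [:C:]) z"
    by eventually_elim (auto simp: algebra_simps)
  thus ?case
    by blast
qed

lemma shift_difference_poly_if_higher_deriv_periodic:
  assumes mero: "h meromorphic_on UNIV"
    and per: "\<forall>\<^sub>\<approx>z\<in>UNIV. (deriv ^^ k) h (z + c) = (deriv ^^ k) h z"
  shows "\<exists>p. \<forall>\<^sub>\<approx>z\<in>UNIV. h (z + c) - h z = poly p z"
proof (rule meromorphic_higher_deriv_zero_imp_poly)
  show "(\<lambda>z. h (z + c) - h z) meromorphic_on UNIV"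
    by (intro meromorphic_intros meromorphic_on_UNIV_shift mero)
  have an: "\<forall>\<^sub>\<approx>z\<in>UNIV. h analytic_on {z}"
    by (rule meromorphic_on_imp_analytic_cosparse[OF mero])
  have an': "\<forall>\<^sub>\<approx>z\<in>UNIV. (\<lambda>w. h (w + c)) analytic_on {z}"
    by (intro meromorphic_on_imp_analytic_cosparse meromorphic_on_UNIV_shift mero)
  show "\<forall>\<^sub>\<approx>z\<in>UNIV. (deriv ^^ k) (\<lambda>z. h (z + c) - h z) z = 0"
    using an an' per by eventually_elim (simp add: higher_deriv_diff_at higher_deriv_shift)
qed

section \<open>Absence of poles\<close>

text \<open>
  A square that tends to 0 can only come from a function with a removable singularity and a zero
  there, and the square of a zero is a multiple zero.
\<close>
lemma deriv_eq_0_at_zero_of_meromorphic_square: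
  assumes mero: "G meromorphic_on {w}" and R: "R analytic_on {w}" "R w = 0"
    and eq: "eventually (\<lambda>z. (G z)\<^sup>2 = R z) (at w)"
  shows "deriv R w = 0"
proof -
  define H where "H = remove_sings G"
  have "eventually (\<lambda>z. H z = G z) (at w)"
    unfolding H_def by (rule eventually_remove_sings_eq_at) (use mero in \<open>simp add: meromorphic_at_iff\<close>)
  with eq have eqH: "eventually (\<lambda>z. (H z)\<^sup>2 = R z) (at w)"
    by eventually_elim simp
  have "(R \<longlongrightarrow> 0) (at w)"
    using analytic_at_imp_isCont[OF R(1)] R(2) by (simp add: isCont_def)
  hence "((\<lambda>z. (H z)\<^sup>2) \<longlongrightarrow> 0) (at w)"
    using eqH by (simp add: tendsto_cong)
  hence "((\<lambda>z. sqrt (norm ((H z)\<^sup>2))) \<longlongrightarrow> sqrt 0) (at w)"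
    by (intro tendsto_real_sqrt tendsto_norm_zero)
  hence lim: "(H \<longlongrightarrow> 0) (at w)"
    by (simp add: norm_power tendsto_norm_zero_iff)
  hence "\<not> is_pole H w"
    using is_pole_def not_tendsto_and_filterlim_at_infinity trivial_limit_at by metis
  hence an: "H analytic_on {w}"
    using remove_sings_nicely_meromorphic[OF mero] unfolding H_def
    by (intro nicely_meromorphic_on_imp_analytic_at) auto
  have "H w = 0"
    using analytic_at_imp_isCont[OF an] lim by (metis isCont_def LIM_unique)
  have "eventually (\<lambda>z. (H z)\<^sup>2 = R z) (nhds w)"
    using eqH \<open>H w = 0\<close> R(2) by (auto simp: eventually_at_filter elim!: eventually_mono) 
  hence "deriv (\<lambda>z. (H z)\<^sup>2) w = deriv R w"
    by (intro deriv_cong_ev) auto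
  moreover have "((\<lambda>z. (H z)\<^sup>2) has_field_derivative 0) (at w)"
    using analytic_derivI[OF an] \<open>H w = 0\<close> by (auto intro!: derivative_eq_intros)
  ultimately show ?thesis
    by (simp add: DERIV_imp_deriv)
qed

lemma poly_dominates_lower_degree_on_far_shifts:
  fixes p q :: "complex poly"
  assumes "degree q < degree p" "c \<noteq> 0" "\<epsilon> > 0"
  shows "\<exists>N. \<forall>n\<ge>N. \<forall>z\<in>ball a r. poly p (z + of_nat n * c) \<noteq> 0 \<and>
           norm (poly q (z + of_nat n * c)) < \<epsilon> * norm (poly p (z + of_nat n * c))"
proof -
  have "eventually (\<lambda>z. norm (poly q z / poly p z) < \<epsilon>) at_infinity"
    using poly_divide_tendsto_0_at_infinity[OF assms(1)] \<open>\<epsilon> > 0\<close>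
    by (auto simp: tendsto_iff)
  then obtain b where b: "\<And>z. norm z \<ge> b \<Longrightarrow> norm (poly q z / poly p z) < \<epsilon>"
    by (auto simp: eventually_at_infinity)
  have "p \<noteq> 0"
    using assms(1) by auto
  then obtain \<delta> R where R: "\<delta> > 0" "R > 0" "\<And>z. norm z \<ge> R \<Longrightarrow> norm (poly p z) \<ge> \<delta>"
    using poly_bounded_below_at_infinity by blast
  obtain N :: nat where N: "real N > (max b R + norm a + r) / norm c"
    using reals_Archimedean2 by blast
  show ?thesis
  proof (intro exI[of _ N] allI impI ballI)
    fix n z assume n: "N \<le> n" and z: "z \<in> ball a r"
    have "max b R + norm a + r < real N * norm c"
      using N \<open>c \<noteq> 0\<close> by (simp add: divide_simps)
    also have "\<dots> \<le> norm (of_nat n * c)"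
      using n by (simp add: norm_mult mult_right_mono)
    finally have "max b R + norm a + r < norm (of_nat n * c)" .
    moreover have "norm z < norm a + r"
      using z norm_triangle_ineq2[of z a] by (simp add: dist_norm norm_minus_commute)
    moreover have "norm (of_nat n * c) \<le> norm (z + of_nat n * c) + norm z"
      by (metis add_diff_cancel_left' norm_triangle_ineq4 add.commute)
    ultimately have far: "norm (z + of_nat n * c) \<ge> b" "norm (z + of_nat n * c) \<ge> R"
      by linarith+
    have ne: "poly p (z + of_nat n * c) \<noteq> 0"
      using R(1) R(3)[OF far(2)] by auto
    show "poly p (z + of_nat n * c) \<noteq> 0 \<and>
           norm (poly q (z + of_nat n * c)) < \<epsilon> * norm (poly p (z + of_nat n * c))"
      using b[OF far(1)] ne by (simp add: norm_divide divide_simps)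
  qed
qed

text \<open>
  If \<open>z0\<close> were a pole, then \<open>h = g\<^sup>2 - Q\<close> would have a pole there, and \<open>h(z) = - Q(z + n * c)\<close>
  would have solutions near \<open>z0\<close> for large \<open>n\<close>. They are zeros of the square \<open>g(z + n * c)\<^sup>2\<close> and
  hence multiple, which equates the large \<open>h' / h\<close> with a small value of \<open>Q' / Q\<close>.
\<close>
lemma no_pole_if_shifted_squares_differ_by_poly:
  assumes mero: "g meromorphic_on UNIV" and "c \<noteq> 0" and "degree Q > 0"
    and eq: "\<forall>\<^sub>\<approx>z\<in>UNIV. (g (z + c))\<^sup>2 - (g z)\<^sup>2 = poly Q (z + c) - poly Q z"
  shows "\<not> is_pole g z0"
proof
  assume pole: "is_pole g z0"
  define h where "h = (\<lambda>z. (g z)\<^sup>2 - poly Q z)"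
  have shift: "\<forall>\<^sub>\<approx>z\<in>UNIV. (g (z + of_nat n * c))\<^sup>2 = h z + poly Q (z + of_nat n * c)" for n
  proof (induction n)
    case (Suc n)
    have "\<forall>\<^sub>\<approx>z\<in>UNIV. (g (z + of_nat n * c + c))\<^sup>2 - (g (z + of_nat n * c))\<^sup>2
            = poly Q (z + of_nat n * c + c) - poly Q (z + of_nat n * c)"
      by (rule eventually_cosparse_UNIV_shift[OF eq])
    with Suc show ?case
      by eventually_elim (simp add: algebra_simps)
  qed (simp add: h_def)
  have hmero: "h meromorphic_on UNIV"
    unfolding h_def
    by (intro meromorphic_intros mero analytic_on_imp_meromorphic_on)
       (auto simp: analytic_on_open intro!: holomorphic_intros)
  have "filterlim (\<lambda>z. (g z)\<^sup>2) at_infinity (at z0)"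
    using pole filterlim_compose[OF filterlim_power_at_infinity[of 2]] by (auto simp: is_pole_def)
  moreover have "((\<lambda>z. - poly Q z) \<longlongrightarrow> - poly Q z0) (at z0)"
    by (intro tendsto_intros)
  ultimately have hpole: "is_pole h z0"
    unfolding h_def is_pole_def
    using tendsto_add_filterlim_at_infinity by fastforce
  have logpole: "is_pole (\<lambda>z. deriv h z / h z) z0"
  proof -
    obtain F where F: "(\<lambda>w. h (z0 + w)) has_laurent_expansion F"
      using hmero by (auto simp: meromorphic_on_def)
    have "F \<noteq> 0"
      using has_laurent_expansion_imp_is_pole_iff[OF F] hpole by auto
    with F hpole show ?thesis
      by (subst is_pole_deriv_divide_iff) auto
  qed
  have "eventually (\<lambda>z. h analytic_on {z}) (at z0)"
    using meromorphic_on_imp_analytic_cosparse[OF hmero] by (simp add: eventually_cosparse_open_eq)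
  moreover have "eventually (\<lambda>z. norm (h z) \<ge> 1) (at z0)"
    using hpole by (auto simp: is_pole_def filterlim_at_infinity[of 0])
  moreover have "eventually (\<lambda>z. norm (deriv h z / h z) \<ge> 1) (at z0)"
    using logpole by (auto simp: is_pole_def filterlim_at_infinity[of 0])
  ultimately have "eventually (\<lambda>z. h analytic_on {z} \<and> h z \<noteq> 0 \<and> norm (deriv h z) \<ge> norm (h z)) (at z0)"
    by eventually_elim (auto simp: norm_divide divide_simps split: if_splits)
  then obtain r where r: "r > 0" 
    "\<And>z. z \<in> ball z0 r - {z0} \<Longrightarrow> h analytic_on {z} \<and> h z \<noteq> 0 \<and> norm (deriv h z) \<ge> norm (h z)"
    by (auto simp: eventually_at dist_commute)
  \<comment> \<open>The holomorphic extension of \<open>1 / h\<close> over the pole, which vanishes exactly at \<open>z0\<close>.\<close>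
  define \<phi> where "\<phi> = (\<lambda>z. if z = z0 then 0 else inverse (h z))"
  have \<phi>: "\<phi> holomorphic_on ball z0 r"
    unfolding \<phi>_def
  proof (rule is_pole_inverse_holomorphic)
    have "h analytic_on (ball z0 r - {z0})"
      using r(2) analytic_on_analytic_at by blast
    thus "h holomorphic_on (ball z0 r - {z0})"
      by (rule analytic_imp_holomorphic)
  qed (use hpole r(2) in auto)
  have lower: "degree (pderiv Q) < degree Q"
    using \<open>degree Q > 0\<close> by (simp add: degree_pderiv)
  obtain N where N: "\<And>n z. n \<ge> N \<Longrightarrow> z \<in> ball z0 r \<Longrightarrow> poly Q (z + of_nat n * c) \<noteq> 0 \<and>
      norm (poly (pderiv Q) (z + of_nat n * c)) < norm (poly Q (z + of_nat n * c))"
    using poly_dominates_lower_degree_on_far_shifts[OF lower \<open>c \<noteq> 0\<close> zero_less_one, of z0 r]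
    unfolding mult_1 by blast
  \<comment> \<open>Starting at index \<open>N\<close> keeps the denominators away from the zeros of \<open>Q\<close>.\<close>
  define \<Phi> where "\<Phi> = (\<lambda>n z. \<phi> z + inverse (poly Q (z + of_nat (N + n) * c)))"
  have "\<exists>n. \<exists>z\<in>ball z0 r. \<Phi> n z = 0"
  proof (rule ccontr)
    assume no_zero: "\<nexists>n. \<exists>z\<in>ball z0 r. \<Phi> n z = 0"
    have "\<phi> z0 \<noteq> 0"
    proof (rule Hurwitz_no_zeros[where S = "ball z0 r" and \<F> = \<Phi> and g = \<phi>])
      show "\<Phi> n holomorphic_on ball z0 r" for n
        unfolding \<Phi>_def by (intro holomorphic_intros \<phi>) (use N[of "N + n"] in auto)
      show "uniform_limit K \<Phi> \<phi> sequentially" if "compact K" "K \<subseteq> ball z0 r" for K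
      proof (rule uniform_limitI)
        fix \<epsilon> :: real assume "\<epsilon> > 0"
        obtain M where M: "\<And>n z. n \<ge> M \<Longrightarrow> z \<in> ball z0 r \<Longrightarrow> poly Q (z + of_nat n * c) \<noteq> 0 \<and>
            norm (poly 1 (z + of_nat n * c)) < \<epsilon> * norm (poly Q (z + of_nat n * c))"
          using poly_dominates_lower_degree_on_far_shifts[of 1 Q, OF _ \<open>c \<noteq> 0\<close> \<open>\<epsilon> > 0\<close>, of z0 r]
            \<open>degree Q > 0\<close> unfolding degree_1 by blast
        have "dist (\<Phi> n z) (\<phi> z) < \<epsilon>" if "n \<ge> M" "z \<in> K" for n z
        proof -
          define x where "x = poly Q (z + of_nat (N + n) * c)"
          have "N + n \<ge> M" "z \<in> ball z0 r"
            using that \<open>K \<subseteq> ball z0 r\<close> by auto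
          hence "x \<noteq> 0" "1 < \<epsilon> * norm x"
            using M[of "N + n" z] unfolding x_def poly_1 norm_one by blast+
          moreover have "dist (\<Phi> n z) (\<phi> z) = 1 / norm x"
            unfolding \<Phi>_def x_def[symmetric]
            by (simp add: dist_norm norm_inverse norm_divide inverse_eq_divide)
          ultimately show ?thesis
            by (simp add: pos_divide_less_eq)
        qed
        thus "\<forall>\<^sub>F n in sequentially. \<forall>z\<in>K. dist (\<Phi> n z) (\<phi> z) < \<epsilon>"
          by (auto simp: eventually_sequentially)
      qed
      show "\<not> \<phi> constant_on ball z0 r"
      proof
        assume "\<phi> constant_on ball z0 r"
        moreover have "z0 + of_real (r / 2) \<in> ball z0 r" "z0 \<in> ball z0 r"
          using \<open>r > 0\<close> by (auto simp: dist_norm)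
        ultimately have "\<phi> (z0 + of_real (r / 2)) = \<phi> z0"
          by (auto simp: constant_on_def)
        thus False
          using r(2)[of "z0 + of_real (r / 2)"] \<open>r > 0\<close> by (auto simp: \<phi>_def dist_norm)
      qed
    qed (use \<phi> \<open>r > 0\<close> no_zero in auto)
    thus False
      by (simp add: \<phi>_def)
  qed
  then obtain n w where w: "w \<in> ball z0 r" "\<Phi> n w = 0"
    by blast
  define m where "m = N + n"
  have m: "poly Q (w + of_nat m * c) \<noteq> 0"
      "norm (poly (pderiv Q) (w + of_nat m * c)) < norm (poly Q (w + of_nat m * c))"
    using N[of m w] w(1) by (auto simp: m_def)
  have "w \<noteq> z0"
    using w(2) m(1) by (auto simp: \<Phi>_def \<phi>_def m_def)
  with w(1) have h: "h analytic_on {w}" "h w \<noteq> 0" "norm (deriv h w) \<ge> norm (h w)"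
    using r(2)[of w] by auto
  have hw: "h w = - poly Q (w + of_nat m * c)"
    using w(2) \<open>w \<noteq> z0\<close> m(1) h(2)
    by (simp add: \<Phi>_def \<phi>_def m_def field_simps eq_neg_iff_add_eq_0)
  define R where "R = (\<lambda>z. h z + poly Q (z + of_nat m * c))"
  have R': "(R has_field_derivative deriv h w + poly (pderiv Q) (w + of_nat m * c)) (at w)"
    unfolding R_def using analytic_derivI[OF h(1)]
    by (auto intro!: derivative_eq_intros)
  have "deriv R w = 0"
  proof (rule deriv_eq_0_at_zero_of_meromorphic_square)
    show "(\<lambda>z. g (z + of_nat m * c)) meromorphic_on {w}"
      by (rule meromorphic_on_UNIV_shift[OF mero])
    have "(\<lambda>z. poly Q (z + of_nat m * c)) analytic_on UNIV"
      by (auto simp: analytic_on_open intro!: holomorphic_intros)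
    hence "(\<lambda>z. poly Q (z + of_nat m * c)) analytic_on {w}"
      by (rule analytic_on_subset) auto
    thus "R analytic_on {w}"
      unfolding R_def by (intro analytic_intros h)
    show "R w = 0"
      by (simp add: R_def hw)
    show "\<forall>\<^sub>F z in at w. (g (z + of_nat m * c))\<^sup>2 = R z"
      using shift[of m] by (simp add: eventually_cosparse_open_eq R_def)
  qed
  with R' have "deriv h w = - poly (pderiv Q) (w + of_nat m * c)"
    by (simp add: DERIV_imp_deriv eq_neg_iff_add_eq_0)
  with h(3) hw m(2) show False
    by simp
qed

section \<open>Meromorphic functions whose square changes by a polynomial\<close>

text \<open>
  Without poles \<open>g\<close> agrees with an entire function \<open>G\<close> off a discrete set, and by continuity \<open>G\<close>
  satisfies the difference equation everywhere.
\<close>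
lemma meromorphic_square_shift_by_poly_imp_rational:
  assumes mero: "g meromorphic_on UNIV" and "c \<noteq> 0" and "P \<noteq> 0"
    and eq: "\<forall>\<^sub>\<approx>z\<in>UNIV. (g (z + c))\<^sup>2 - (g z)\<^sup>2 = poly P z"
  shows "rational_function g"
proof -
  obtain Q where Q: "\<And>z. poly Q (z + c) - poly Q z = poly P z"
    using poly_difference_equation[OF \<open>c \<noteq> 0\<close>] by blast
  have "degree Q > 0"
  proof (rule ccontr)
    assume "\<not> degree Q > 0"
    then obtain \<kappa> where "Q = [:\<kappa>:]"
      using degree_eq_zeroE by blast
    hence "\<forall>z. poly P z = 0"
      using Q by auto
    thus False
      using \<open>P \<noteq> 0\<close> poly_all_0_iff_0 by blast
  qed
  define G where "G = remove_sings g"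
  have Gg: "\<forall>\<^sub>\<approx>z\<in>UNIV. G z = g z"
    unfolding G_def by (rule eventually_remove_sings_eq[OF mero])
  have "\<not> is_pole G z" for z
  proof -
    have "is_pole G z \<longleftrightarrow> is_pole g z"
      by (rule is_pole_cong) (use Gg in \<open>auto simp: eventually_cosparse_open_eq\<close>)
    thus ?thesis
      using no_pole_if_shifted_squares_differ_by_poly[OF mero \<open>c \<noteq> 0\<close> \<open>degree Q > 0\<close>] eq Q by auto
  qed
  hence "G analytic_on {z}" for z
    using nicely_meromorphic_on_imp_analytic_at remove_sings_nicely_meromorphic[OF mero]
    unfolding G_def by blast
  hence hol: "G holomorphic_on UNIV"
    using analytic_on_analytic_at analytic_imp_holomorphic by blast
  hence cont: "continuous_on UNIV G"
    by (rule holomorphic_on_imp_continuous_on)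
  have "(G (z + c))\<^sup>2 - (G z)\<^sup>2 = poly P z" for z
  proof -
    define E where "E = (\<lambda>z. (G (z + c))\<^sup>2 - (G z)\<^sup>2 - poly P z)"
    have "\<forall>\<^sub>\<approx>z\<in>UNIV. E z = 0"
      using eq Gg eventually_cosparse_UNIV_shift[OF Gg, of c]
      unfolding E_def by eventually_elim simp
    hence "(E \<longlongrightarrow> 0) (at z)"
      by (auto simp: eventually_cosparse_open_eq intro: tendsto_eventually)
    moreover have "continuous_on UNIV E"
      unfolding E_def
      by (intro continuous_intros cont continuous_on_compose2[OF cont]) auto
    hence "(E \<longlongrightarrow> E z) (at z)"
      by (auto simp: continuous_on_eq_continuous_at isCont_def)
    ultimately have "E z = 0"
      using LIM_unique by blast
    thus ?thesis
      by (simp add: E_def)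
  qed
  from entire_square_shift_by_poly_imp_poly[OF hol \<open>P \<noteq> 0\<close> this]
  obtain p where "\<And>z. G z = poly p z"
    by blast
  with Gg have "\<forall>\<^sub>\<approx>z\<in>UNIV. g z = poly p z / poly 1 z"
    by (auto elim: eventually_mono)
  thus ?thesis
    unfolding rational_function_def by (intro exI[of _ p] exI[of _ 1]) auto
qed

text \<open>
  At almost every point \<open>g(z + c)\<close> is \<open>g(z)\<close> or \<open>- g(z)\<close>, and by the identity theorem the sign
  does not depend on the point. In the second case the period is \<open>2 * c\<close>.
\<close>
lemma periodic_if_square_periodic:
  assumes mero: "g meromorphic_on UNIV" and "c \<noteq> 0"
    and eq: "\<forall>\<^sub>\<approx>z\<in>UNIV. (g (z + c))\<^sup>2 = (g z)\<^sup>2"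
  shows "periodic_meromorphic g"
proof -
  have "(\<lambda>z. g (z + c) - g z) meromorphic_on UNIV"
    by (intro meromorphic_intros meromorphic_on_UNIV_shift mero)
  hence "(\<forall>\<^sub>\<approx>z\<in>UNIV. g (z + c) - g z = 0) \<or> (\<forall>\<^sub>\<approx>z\<in>UNIV. g (z + c) - g z \<noteq> 0)"
    by (rule meromorphic_imp_constant_or_avoid) auto
  thus ?thesis
  proof
    assume "\<forall>\<^sub>\<approx>z\<in>UNIV. g (z + c) - g z = 0"
    with \<open>c \<noteq> 0\<close> show ?thesis
      unfolding periodic_meromorphic_def by (intro exI[of _ c]) auto
  next
    assume "\<forall>\<^sub>\<approx>z\<in>UNIV. g (z + c) - g z \<noteq> 0"
    with eq have neg: "\<forall>\<^sub>\<approx>z\<in>UNIV. g (z + c) = - g z"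
      by eventually_elim (auto simp: power2_eq_iff)
    from eventually_cosparse_UNIV_shift[OF this, of c] neg
    have "\<forall>\<^sub>\<approx>z\<in>UNIV. g (z + 2 * c) = g z"
      by eventually_elim (simp add: algebra_simps)
    with \<open>c \<noteq> 0\<close> show ?thesis
      unfolding periodic_meromorphic_def by (intro exI[of _ "2 * c"]) auto
  qed
qed

theorem theorem1p2:
  fixes f :: "complex \<Rightarrow> complex" and k :: nat and a1 a2 :: complex
  assumes "transcendental_meromorphic f"
    and "k > 0"
    and "a2 \<noteq> 0"
    and "periodic_meromorphic ((deriv ^^ k) (\<lambda>z. a2 * (f z)\<^sup>2 + a1 * f z))"
  shows "periodic_meromorphic f"
proof -
  define b where "b = a1 / (2 * a2)"
  define g where "g = (\<lambda>z. f z + b)"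
  define h where "h = (\<lambda>z. a2 * (f z)\<^sup>2 + a1 * f z)"
  have fmero: "f meromorphic_on UNIV" and trans: "\<not> rational_function f"
    using assms(1) by (auto simp: transcendental_meromorphic_def)
  have gmero: "g meromorphic_on UNIV" and hmero: "h meromorphic_on UNIV"
    unfolding g_def h_def by (intro meromorphic_intros fmero)+
  have h_eq: "h z = a2 * (g z)\<^sup>2 - a2 * b\<^sup>2" for z
    using \<open>a2 \<noteq> 0\<close> by (simp add: h_def g_def b_def power2_eq_square field_simps)
  obtain c where "c \<noteq> 0" and per: "\<forall>\<^sub>\<approx>z\<in>UNIV. (deriv ^^ k) h (z + c) = (deriv ^^ k) h z"
    using assms(4) by (auto simp: periodic_meromorphic_def h_def)
  obtain p where p: "\<forall>\<^sub>\<approx>z\<in>UNIV. h (z + c) - h z = poly p z"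
    using shift_difference_poly_if_higher_deriv_periodic[OF hmero per] by blast
  define P where "P = smult (inverse a2) p"
  have eq: "\<forall>\<^sub>\<approx>z\<in>UNIV. (g (z + c))\<^sup>2 - (g z)\<^sup>2 = poly P z"
    using p by eventually_elim (use \<open>a2 \<noteq> 0\<close> in \<open>auto simp: h_eq P_def field_simps\<close>)
  have "P = 0"
  proof (rule ccontr)
    assume "P \<noteq> 0"
    then obtain r q where "q \<noteq> 0" and rq: "\<forall>\<^sub>\<approx>z\<in>UNIV. g z = poly r z / poly q z"
      using meromorphic_square_shift_by_poly_imp_rational[OF gmero \<open>c \<noteq> 0\<close> _ eq]
      by (auto simp: rational_function_def)
    have "\<forall>\<^sub>\<approx>z\<in>UNIV. poly q z \<noteq> 0"
    proof -
      have "finite {z. poly q z = 0}"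
        using \<open>q \<noteq> 0\<close> poly_roots_finite by blast
      hence "{z. poly q z = 0} sparse_in UNIV"
        by (simp add: sparse_in_open islimpt_finite)
      thus ?thesis
        by (simp add: eventually_cosparse)
    qed
    with rq have "\<forall>\<^sub>\<approx>z\<in>UNIV. f z = poly (r - smult b q) z / poly q z"
      by eventually_elim (simp add: g_def field_simps)
    with \<open>q \<noteq> 0\<close> trans show False
      unfolding rational_function_def by blast
  qed
  with eq have "periodic_meromorphic g"
    by (intro periodic_if_square_periodic[OF gmero \<open>c \<noteq> 0\<close>]) (auto elim: eventually_mono)
  thus ?thesis
    by (simp add: periodic_meromorphic_def g_def)
qed

end
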